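(* Let $G$ be a Lie group acting properly and smoothly on a smooth manifold $M$, and let $\mathfrak{M}_0$ be the set of locally minimal strata of the action. Then $$|\mathfrak{M}_0|\;\leq\;\sum_{\mathcal{M}_x\in\mathfrak{M}_0}\mathrm{cat}_G(\mathcal{M}_x)\;\leq\;\mathrm{cat}_G(M).$$
   Context: An action of $G$ on $M$ is proper if the map $G\times M\to M\times M$, $(g,x)\mapsto(gx,x)$, is proper. Equivariant category: for a topological group $G$ acting on a space $X$, an open $G$-invariant set $U\subset X$ is $G$-categorical (in $X$) if there is a homotopy $H:U\times[0,1]\to X$ with $gH(x,t)=H(gx,t)$ for all $g\in G$, $x\in U$, $t\in[0,1]$, such that $H_0$ is the inclusion and $H_1$ maps $U$ into a single $G$-orbit. $\mathrm{cat}_G(X)$ is the least number of $G$-categorical sets needed to cover $X$ ($\infty$ if there is no such finite cover, $0$ if $X=\emptyset$). A $G$-invariant subset of $M$ is regarded as a $G$-space in its own right with the subspace topology. Orbit types: $G_x$ is the stabilizer of $x$ and $(H)$ denotes the conjugacy class of a subgroup $H$ in $G$. The orbit type of the orbit $Gx$ is $(G_x)$. For isotropy groups $H,K$, write $(H)\leq(K)$ if $gKg^{-1}\subset H$ for some $g\in G$ (this is a partial order on orbit types). Let $M_{(H)}=\{x\in M\mid G_x\in(H)\}$. Strata: for $x\in M$, $\mathcal{M}_x=G\cdot (M_{(G_x)})_x$, where $(M_{(G_x)})_x$ is the connected component of $M_{(G_x)}$ containing $x$. The sets $\mathcal{M}_x$ partition $M$. The orbit $Gx$, and the stratum $\mathcal{M}_x$,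 are called locally minimal if the closure $\overline{\mathcal{M}}_x$ has a $G$-invariant open neighborhood $U$ that contains no smaller orbit type, i.e. there is no $y\in U$ with $(G_y)\leq(G_x)$ and $(G_y)\neq(G_x)$. $\mathfrak{M}_0$ is the set of locally minimal strata. *)

theory Defs
  imports "HOL-Analysis.Analysis" "HOL-Algebra.Group_Action"
begin

no_notation eq_closure_of (\<open>closure'_of\<index>\<close>)

section \<open>Smooth manifolds\<close>

text \<open>
  The model of an \<open>n\<close>-dimensional manifold is \<^const>\<open>Euclidean_space\<close>~\<open>n\<close>, the sequences that vanish from
  index \<open>n\<close> on. The dimension is thus a number and may be \<open>0\<close>, which a type of class
  \<open>euclidean_space\<close> would not allow; discrete groups are Lie groups of dimension \<open>0\<close>.
\<close>

text \<open>
  \<open>C\<^sup>k\<close> functions in \<open>n\<close> variables: all iterated partial derivatives up to order \<open>k\<close> exist and are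
  continuous. The set \<open>S\<close> is meant to be open in \<open>Euclidean_space n\<close>.
\<close>

primrec Ck_on :: "nat \<Rightarrow> nat \<Rightarrow> (nat \<Rightarrow> real) set \<Rightarrow> ((nat \<Rightarrow> real) \<Rightarrow> real) \<Rightarrow> bool" where
  "Ck_on n 0 S f \<longleftrightarrow> continuous_map (subtopology (Euclidean_space n) S) euclideanreal f"
| "Ck_on n (Suc k) S f \<longleftrightarrow>
     continuous_map (subtopology (Euclidean_space n) S) euclideanreal f \<and>
     (\<forall>i<n. \<exists>f'. (\<forall>x\<in>S. ((\<lambda>t. f (x(i := t))) has_real_derivative f' x) (at (x i))) \<and>
                 Ck_on n k S f')"

definition smooth_between ::
  "nat \<Rightarrow> nat \<Rightarrow> (nat \<Rightarrow> real) set \<Rightarrow> ((nat \<Rightarrow> real) \<Rightarrow> nat \<Rightarrow> real) \<Rightarrow> bool" where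
  "smooth_between n m S F \<longleftrightarrow> (\<forall>j<m. \<forall>k. Ck_on n k S (\<lambda>x. F x j))"

type_synonym 'a chart = "'a set \<times> ('a \<Rightarrow> nat \<Rightarrow> real)"

text \<open>The smooth structure is the one generated by the atlas, which need not be maximal.\<close>

record 'a mfd =
  mtop :: "'a topology"
  mdim :: nat
  atlas :: "'a chart set"

definition is_chart :: "nat \<Rightarrow> 'a topology \<Rightarrow> 'a chart \<Rightarrow> bool" where
  "is_chart n X = (\<lambda>(U, \<psi>). openin X U \<and> openin (Euclidean_space n) (\<psi> ` U) \<and>
     homeomorphic_map (subtopology X U) (subtopology (Euclidean_space n) (\<psi> ` U)) \<psi>)"

definition smooth_manifold :: "'a mfd \<Rightarrow> bool" where
  "smooth_manifold M \<longleftrightarrow>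
     Hausdorff_space (mtop M) \<and> second_countable (mtop M) \<and>
     (\<forall>c\<in>atlas M. is_chart (mdim M) (mtop M) c) \<and>
     (\<Union>(U, \<psi>)\<in>atlas M. U) = topspace (mtop M) \<and>
     (\<forall>(U, \<psi>)\<in>atlas M. \<forall>(V, \<theta>)\<in>atlas M.
        smooth_between (mdim M) (mdim M) (\<psi> ` (U \<inter> V)) (\<theta> \<circ> inv_into U \<psi>))"

definition smooth_map :: "'a mfd \<Rightarrow> 'b mfd \<Rightarrow> ('a \<Rightarrow> 'b) \<Rightarrow> bool" where
  "smooth_map M N f \<longleftrightarrow>
     continuous_map (mtop M) (mtop N) f \<and>
     (\<forall>(U, \<psi>)\<in>atlas M. \<forall>(V, \<theta>)\<in>atlas N.
        smooth_between (mdim M) (mdim N) (\<psi> ` (U \<inter> f -` V)) (\<theta> \<circ> f \<circ> inv_into U \<psi>))"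

text \<open>A chart of the product lists the coordinates of the first factor before those of the second.\<close>

definition prod_chart :: "nat \<Rightarrow> 'a chart \<Rightarrow> 'b chart \<Rightarrow> ('a \<times> 'b) chart" where
  "prod_chart n c d =
     (fst c \<times> fst d, \<lambda>(x, y) i. if i < n then snd c x i else snd d y (i - n))"

definition prod_mfd :: "'a mfd \<Rightarrow> 'b mfd \<Rightarrow> ('a \<times> 'b) mfd" where
  "prod_mfd M N = \<lparr>mtop = prod_topology (mtop M) (mtop N), mdim = mdim M + mdim N,
     atlas = {prod_chart (mdim M) c d | c d. c \<in> atlas M \<and> d \<in> atlas N}\<rparr>"


section \<open>Lie groups and their actions\<close>

definition lie_group :: "('g, 'r) monoid_scheme \<Rightarrow> 'g mfd \<Rightarrow> bool" where
  "lie_group G L \<longleftrightarrow>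
     group G \<and> smooth_manifold L \<and> topspace (mtop L) = carrier G \<and>
     smooth_map (prod_mfd L L) L (\<lambda>(g, h). g \<otimes>\<^bsub>G\<^esub> h) \<and>
     smooth_map L L (\<lambda>g. inv\<^bsub>G\<^esub> g)"

definition smooth_action ::
  "('g, 'r) monoid_scheme \<Rightarrow> 'g mfd \<Rightarrow> 'm mfd \<Rightarrow> ('g \<Rightarrow> 'm \<Rightarrow> 'm) \<Rightarrow> bool" where
  "smooth_action G L M \<phi> \<longleftrightarrow>
     group_action G (topspace (mtop M)) \<phi> \<and>
     smooth_map (prod_mfd L M) M (\<lambda>(g, x). \<phi> g x)"

text \<open>
  \<^const>\<open>proper_map\<close> does not ask for continuity, which for this map follows from smoothness of the action.
\<close>

definition proper_action ::
  "'g topology \<Rightarrow> 'm topology \<Rightarrow> ('g \<Rightarrow> 'm \<Rightarrow> 'm) \<Rightarrow> bool" where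
  "proper_action TG X \<phi> \<longleftrightarrow>
     proper_map (prod_topology TG X) (prod_topology X X) (\<lambda>(g, x). (\<phi> g x, x))"


section \<open>Equivariant category\<close>

definition invariant_set ::
  "('g, 'r) monoid_scheme \<Rightarrow> ('g \<Rightarrow> 'm \<Rightarrow> 'm) \<Rightarrow> 'm set \<Rightarrow> bool" where
  "invariant_set G \<phi> U \<longleftrightarrow> (\<forall>g\<in>carrier G. \<phi> g ` U \<subseteq> U)"

text \<open>
  Here \<open>X\<close> may be any invariant subspace of the space on which \<open>G\<close> acts: \<open>\<phi>\<close> is only evaluated at
  points of \<open>X\<close>, so an invariant subset becomes a \<open>G\<close>-space through its subspace topology alone.
\<close>

definition G_categorical ::
  "('g, 'r) monoid_scheme \<Rightarrow> ('g \<Rightarrow> 'm \<Rightarrow> 'm) \<Rightarrow> 'm topology \<Rightarrow> 'm set \<Rightarrow> bool" where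
  "G_categorical G \<phi> X U \<longleftrightarrow>
     openin X U \<and> invariant_set G \<phi> U \<and>
     (\<exists>H. continuous_map (prod_topology (subtopology X U) (top_of_set {0..1::real})) X H \<and>
          (\<forall>g\<in>carrier G. \<forall>x\<in>U. \<forall>t\<in>{0..1}. \<phi> g (H (x, t)) = H (\<phi> g x, t)) \<and>
          (\<forall>x\<in>U. H (x, 0) = x) \<and>
          (\<exists>y\<in>topspace X. \<forall>x\<in>U. H (x, 1) \<in> orbit G \<phi> y))"

text \<open>The infimum of the empty set is \<open>\<infinity>\<close>; for empty \<open>X\<close> the empty cover gives \<open>0\<close>.\<close>

definition cat_G ::
  "('g, 'r) monoid_scheme \<Rightarrow> ('g \<Rightarrow> 'm \<Rightarrow> 'm) \<Rightarrow> 'm topology \<Rightarrow> enat" where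
  "cat_G G \<phi> X =
     Inf {enat (card C) | C. finite C \<and> (\<forall>U\<in>C. G_categorical G \<phi> X U) \<and> \<Union>C = topspace X}"


section \<open>Orbit types and strata\<close>

definition conj_set :: "('g, 'r) monoid_scheme \<Rightarrow> 'g \<Rightarrow> 'g set \<Rightarrow> 'g set" where
  "conj_set G g H = (\<lambda>h. g \<otimes>\<^bsub>G\<^esub> h \<otimes>\<^bsub>G\<^esub> inv\<^bsub>G\<^esub> g) ` H"

definition conj_class :: "('g, 'r) monoid_scheme \<Rightarrow> 'g set \<Rightarrow> 'g set set" where
  "conj_class G H = {conj_set G g H | g. g \<in> carrier G}"

text \<open>
  The order \<open>(H) \<le> (K)\<close> on conjugacy classes, in terms of representatives. Larger isotropy means
  smaller orbit type.
\<close>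

definition orbit_type_le ::
  "('g, 'r) monoid_scheme \<Rightarrow> 'g set \<Rightarrow> 'g set \<Rightarrow> bool" where
  "orbit_type_le G H K \<longleftrightarrow> (\<exists>g\<in>carrier G. conj_set G g K \<subseteq> H)"

definition orbit_type_set ::
  "('g, 'r) monoid_scheme \<Rightarrow> ('g \<Rightarrow> 'm \<Rightarrow> 'm) \<Rightarrow> 'm topology \<Rightarrow> 'g set \<Rightarrow> 'm set" where
  "orbit_type_set G \<phi> X H = {x \<in> topspace X. stabilizer G \<phi> x \<in> conj_class G H}"

definition stratum ::
  "('g, 'r) monoid_scheme \<Rightarrow> ('g \<Rightarrow> 'm \<Rightarrow> 'm) \<Rightarrow> 'm topology \<Rightarrow> 'm \<Rightarrow> 'm set" where
  "stratum G \<phi> X x =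
     {\<phi> g y | g y. g \<in> carrier G \<and>
        y \<in> connected_component_of_set
              (subtopology X (orbit_type_set G \<phi> X (stabilizer G \<phi> x))) x}"

definition locally_minimal ::
  "('g, 'r) monoid_scheme \<Rightarrow> ('g \<Rightarrow> 'm \<Rightarrow> 'm) \<Rightarrow> 'm topology \<Rightarrow> 'm \<Rightarrow> bool" where
  "locally_minimal G \<phi> X x \<longleftrightarrow>
     (\<exists>U. openin X U \<and> invariant_set G \<phi> U \<and> X closure_of (stratum G \<phi> X x) \<subseteq> U \<and>
        \<not> (\<exists>y\<in>U. orbit_type_le G (stabilizer G \<phi> y) (stabilizer G \<phi> x) \<and>
                  conj_class G (stabilizer G \<phi> y) \<noteq> conj_class G (stabilizer G \<phi> x)))"

definition locally_minimal_strata ::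
  "('g, 'r) monoid_scheme \<Rightarrow> ('g \<Rightarrow> 'm \<Rightarrow> 'm) \<Rightarrow> 'm topology \<Rightarrow> 'm set set" where
  "locally_minimal_strata G \<phi> X =
     {stratum G \<phi> X x | x. x \<in> topspace X \<and> locally_minimal G \<phi> X x}"

definition ecard :: "'a set \<Rightarrow> enat" where
  "ecard A = (if finite A then enat (card A) else \<infinity>)"

end

theory Submission
  imports Defs
begin

text \<open>
  Along an equivariant homotopy the isotropy groups can only grow, since \<open>G\<^sub>x\<close> fixes the whole track
  of \<open>x\<close>. Hence a track that starts in a locally minimal stratum cannot change its orbit type as long
  as it stays close to the closure of the stratum, and so by connectedness it never leaves the stratum.
  A categorical subset of \<open>M\<close> therefore restricts to a categorical subset of every locally minimal
  stratum that it meets, and it meets at most one of them, because its target orbit lies in each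
  stratum that it meets.
\<close>

section \<open>Maps from locally connected spaces\<close>

text \<open>A clopen argument. Membership in \<open>N\<close> is controlled only while
  \<open>p\<close> stays in \<open>W\<close>, so escape from \<open>W\<close> has to be excluded
  topologically. The component \<open>Q\<close> of \<open>t0\<close> in the preimage of
  \<open>W\<close> is open by local connectedness, and it is closed because \<open>W\<close>
  contains the whole closure of the target component.\<close>

lemma image_subset_connected_component_of:
  assumes T: "connected_space T" "locally_connected_space T"
    and p: "continuous_map T X p"
    and W: "openin X W" "X closure_of connected_component_of_set (subtopology X N) x \<subseteq> W"
    and N: "\<And>t. t \<in> topspace T \<Longrightarrow> p t \<in> W \<Longrightarrow> p t \<in> N"
    and t0: "t0 \<in> topspace T" "p t0 \<in> connected_component_of_set (subtopology X N) x"
  shows "p ` topspace T \<subseteq> connected_component_of_set (subtopology X N) x"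
proof -
  let ?C = "connected_component_of_set (subtopology X N) x"
  define V where "V = {t \<in> topspace T. p t \<in> W}"
  define Q where "Q = connected_component_of_set (subtopology T V) t0"
  have V: "openin T V"
    unfolding V_def using openin_continuous_map_preimage[OF p W(1)] .
  have CX: "?C \<subseteq> topspace X"
    using connected_component_of_subset_topspace[of "subtopology X N" x] by auto
  have t0V: "t0 \<in> V"
    using t0 CX W(2) closure_of_subset[OF CX] by (auto simp: V_def)
  have QV: "Q \<subseteq> V"
    using connected_component_of_subset_topspace[of "subtopology T V" t0] by (auto simp: Q_def)
  have VT: "V \<subseteq> topspace T"
    by (auto simp: V_def)
  have t0Q: "t0 \<in> Q"
    using t0V VT by (auto simp: Q_def connected_component_of_refl)
  have Qopen: "openin T Q"
    using T(2) V t0V unfolding Q_def locally_connected_space_eq_open_connected_component_of by blast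
  have Qconn: "connectedin T Q"
    using connectedin_connected_component_of[of "subtopology T V" t0]
    by (simp add: Q_def connectedin_subtopology)
  have "connectedin (subtopology X N) (p ` Q)"
    using connectedin_continuous_map_image[OF p Qconn] QV N
    by (auto simp: connectedin_subtopology V_def)
  then have "p ` Q \<subseteq> connected_component_of_set (subtopology X N) (p t0)"
    using t0Q by (intro connected_component_of_maximal) auto
  moreover have "connected_component_of (subtopology X N) (p t0) = connected_component_of (subtopology X N) x"
    using t0(2) by (metis connected_component_of_equiv mem_Collect_eq)
  ultimately have QC: "p ` Q \<subseteq> ?C"
    by simp
  \<comment> \<open>Limits of \<open>Q\<close> are mapped into the closure of \<open>?C\<close>,
    hence still into \<open>W\<close>. So the closure of \<open>Q\<close> is a connected subset of
    \<open>V\<close> that contains \<open>t0\<close>, and maximality of \<open>Q\<close> absorbs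
    it.\<close>
  have "p ` (T closure_of Q) \<subseteq> X closure_of (p ` Q)"
    using p by (rule continuous_map_image_closure_subset)
  also have "\<dots> \<subseteq> X closure_of ?C"
    using QC by (rule closure_of_mono)
  finally have "T closure_of Q \<subseteq> V"
    using W(2) closure_of_subset_topspace[of T Q] by (auto simp: V_def)
  then have "connectedin (subtopology T V) (T closure_of Q)"
    using connectedin_closure_of[OF Qconn] by (simp add: connectedin_subtopology)
  then have "T closure_of Q \<subseteq> Q"
    unfolding Q_def using closure_of_subset[of Q T] t0Q QV VT
    by (intro connected_component_of_maximal) (auto simp: Q_def)
  then have "closedin T Q"
    using closure_of_subset_eq QV VT by blast
  then have "Q = topspace T"
    using T(1) Qopen t0Q unfolding connected_space_clopen_in by blast
  then show ?thesis
    using QC by simp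
qed

section \<open>Orbit types and strata of a continuous action\<close>

text \<open>The setting in which the argument runs: a group that acts by continuous translations.
  Smooth actions of Lie groups are shown to be instances at the end.\<close>

locale continuous_action = group_action G "topspace X" \<phi>
  for G (structure) and X :: "'m topology" and \<phi> +
  assumes continuous_map_act: "g \<in> carrier G \<Longrightarrow> continuous_map X X (\<phi> g)"
begin

abbreviation "orbit_type_of x \<equiv> orbit_type_set G \<phi> X (stabilizer G \<phi> x)"
abbreviation "component x \<equiv> connected_component_of_set (subtopology X (orbit_type_of x)) x"

lemma is_group: "group G"
  using group_hom group_hom.axioms(1) by blast

lemma act_inv: "g \<in> carrier G \<Longrightarrow> x \<in> topspace X \<Longrightarrow> \<phi> (inv g) (\<phi> g x) = x"
  using orbit_sym_aux by blast

section \<open>Conjugate subgroups and the isotropy along an orbit\<close>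

lemma conj_set_mult:
  assumes "g \<in> carrier G" "h \<in> carrier G" "H \<subseteq> carrier G"
  shows "conj_set G g (conj_set G h H) = conj_set G (g \<otimes> h) H"
proof -
  interpret group G by (rule is_group)
  have "g \<otimes> (h \<otimes> k \<otimes> inv h) \<otimes> inv g = g \<otimes> h \<otimes> k \<otimes> inv (g \<otimes> h)" if "k \<in> H" for k
    using assms that by (auto simp: inv_mult_group m_assoc subset_iff)
  then show ?thesis
    by (simp add: conj_set_def image_image cong: image_cong)
qed

lemma conj_set_one: "H \<subseteq> carrier G \<Longrightarrow> conj_set G \<one> H = H"
proof -
  interpret group G by (rule is_group)
  assume "H \<subseteq> carrier G"
  then have "\<one> \<otimes> k \<otimes> inv \<one> = k" if "k \<in> H" for k
    using that by auto
  then show ?thesis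
    by (simp add: conj_set_def cong: image_cong)
qed

lemma mem_conj_class_self: "H \<subseteq> carrier G \<Longrightarrow> H \<in> conj_class G H"
  unfolding conj_class_def
  by (metis (mono_tags, lifting) conj_set_one group.is_monoid[OF is_group] mem_Collect_eq monoid.one_closed)

lemma conj_class_conj_set:
  assumes "g \<in> carrier G" "H \<subseteq> carrier G"
  shows "conj_class G (conj_set G g H) = conj_class G H"
proof -
  interpret group G by (rule is_group)
  have "conj_set G k H = conj_set G (k \<otimes> inv g) (conj_set G g H)" if "k \<in> carrier G" for k
    using assms that by (simp add: conj_set_mult m_assoc)
  then have "\<exists>h\<in>carrier G. conj_set G k H = conj_set G h (conj_set G g H)" if "k \<in> carrier G" for k
    using assms that by blast
  moreover have "\<exists>h\<in>carrier G. conj_set G k (conj_set G g H) = conj_set G h H" if "k \<in> carrier G" for k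
    using assms that conj_set_mult by blast
  ultimately show ?thesis
    unfolding conj_class_def by blast
qed

lemma conj_class_eq:
  "H \<subseteq> carrier G \<Longrightarrow> K \<in> conj_class G H \<Longrightarrow> conj_class G K = conj_class G H"
  using conj_class_conj_set by (auto simp: conj_class_def[of G H])

lemma stabilizer_act:
  assumes g: "g \<in> carrier G" and x: "x \<in> topspace X"
  shows "stabilizer G \<phi> (\<phi> g x) = conj_set G g (stabilizer G \<phi> x)"
proof -
  interpret group G by (rule is_group)
  have gx: "\<phi> g x \<in> topspace X"
    using element_image g x by blast
  have sub: "conj_set G h (stabilizer G \<phi> z) \<subseteq> stabilizer G \<phi> (\<phi> h z)"
    if h: "h \<in> carrier G" and z: "z \<in> topspace X" for h z
  proof
    fix k assume "k \<in> conj_set G h (stabilizer G \<phi> z)"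
    then obtain s where s: "s \<in> carrier G" "\<phi> s z = z" "k = h \<otimes> s \<otimes> inv h"
      by (auto simp: conj_set_def stabilizer_def)
    have "\<phi> h z \<in> topspace X"
      using element_image h z by blast
    then have "\<phi> k (\<phi> h z) = \<phi> h (\<phi> s (\<phi> (inv h) (\<phi> h z)))"
      using s h z by (simp add: composition_rule act_inv)
    then show "k \<in> stabilizer G \<phi> (\<phi> h z)"
      using s h z by (simp add: stabilizer_def act_inv)
  qed
  \<comment> \<open>The reverse inclusion is \<open>sub\<close> for \<open>inv g\<close> at the
    point \<open>\<phi> g x\<close>, conjugated back by \<open>g\<close>.\<close>
  have "conj_set G (inv g) (stabilizer G \<phi> (\<phi> g x)) \<subseteq> stabilizer G \<phi> x"
    using sub[of "inv g" "\<phi> g x"] g gx x by (simp add: act_inv)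
  then have "conj_set G g (conj_set G (inv g) (stabilizer G \<phi> (\<phi> g x))) \<subseteq> conj_set G g (stabilizer G \<phi> x)"
    unfolding conj_set_def[of G g] by blast
  then have "stabilizer G \<phi> (\<phi> g x) \<subseteq> conj_set G g (stabilizer G \<phi> x)"
    using g stabilizer_subset by (simp add: conj_set_mult conj_set_one)
  with sub[OF g x] show ?thesis
    by blast
qed

text \<open>Replaces membership in a conjugacy class by equality of classes, so that orbit types can
  be compared by symmetry and transitivity.\<close>

lemma mem_orbit_type_of_iff:
  "y \<in> orbit_type_of x \<longleftrightarrow>
     y \<in> topspace X \<and> conj_class G (stabilizer G \<phi> y) = conj_class G (stabilizer G \<phi> x)"
  unfolding orbit_type_set_def
  using conj_class_eq[OF stabilizer_subset] mem_conj_class_self[OF stabilizer_subset] by auto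

lemma act_mem_orbit_type_of:
  "g \<in> carrier G \<Longrightarrow> y \<in> orbit_type_of x \<Longrightarrow> \<phi> g y \<in> orbit_type_of x"
  using element_image
  by (auto simp: mem_orbit_type_of_iff stabilizer_act conj_class_conj_set stabilizer_subset)

section \<open>Strata as unions of translated components, and their disjointness\<close>

lemma component_subset: "component x \<subseteq> orbit_type_of x" "component x \<subseteq> topspace X"
  using connected_component_of_subset_topspace[of "subtopology X (orbit_type_of x)" x] by auto

lemma mem_component_self: "x \<in> topspace X \<Longrightarrow> x \<in> component x"
  by (simp add: connected_component_of_refl mem_orbit_type_of_iff)

lemma mem_stratum_iff: "z \<in> stratum G \<phi> X x \<longleftrightarrow> (\<exists>g\<in>carrier G. \<exists>y\<in>component x. z = \<phi> g y)"
  unfolding stratum_def by blast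

lemma component_subset_stratum: "component x \<subseteq> stratum G \<phi> X x"
proof
  interpret group G by (rule is_group)
  fix y assume y: "y \<in> component x"
  \<comment> \<open>\<open>id_eq_one\<close> identifies \<open>\<phi> \<one>\<close> with the
    identity restricted to the space, hence the appeal to \<open>component_subset\<close>.\<close>
  then have "\<phi> \<one> y = y"
    using component_subset id_eq_one by (metis restrict_apply' subsetD)
  then show "y \<in> stratum G \<phi> X x"
    using y mem_stratum_iff one_closed by metis
qed

lemma stratum_subset_topspace: "stratum G \<phi> X x \<subseteq> topspace X"
  using component_subset(2) element_image by (fastforce simp: mem_stratum_iff)

lemma act_mem_stratum:
  assumes "g \<in> carrier G" "z \<in> stratum G \<phi> X x"
  shows "\<phi> g z \<in> stratum G \<phi> X x"
proof -
  interpret group G by (rule is_group)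
  obtain h y where "h \<in> carrier G" "y \<in> component x" "z = \<phi> h y"
    using assms mem_stratum_iff by blast
  moreover from this have "\<phi> g (\<phi> h y) = \<phi> (g \<otimes> h) y"
    using assms component_subset(2)[of x] by (auto simp: composition_rule)
  ultimately show ?thesis
    unfolding mem_stratum_iff using assms m_closed by blast
qed

text \<open>The point \<open>\<phi> g y\<close> has the orbit type of both \<open>x\<close> and
  \<open>x'\<close>, so the two orbit type sets coincide. The translated component is then a
  connected subset of this set that meets \<open>component x'\<close>.\<close>

lemma act_component_subset:
  assumes g: "g \<in> carrier G" and y: "y \<in> component x" and gy: "\<phi> g y \<in> component x'"
  shows "\<phi> g ` component x \<subseteq> component x'"
proof -
  have type: "orbit_type_of x = orbit_type_of x'"
  proof -
    have "\<phi> g y \<in> orbit_type_of x" "\<phi> g y \<in> orbit_type_of x'"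
      using component_subset(1) y gy act_mem_orbit_type_of[OF g] by blast+
    then have "conj_class G (stabilizer G \<phi> x) = conj_class G (stabilizer G \<phi> x')"
      by (simp add: mem_orbit_type_of_iff)
    then show ?thesis
      by (simp add: orbit_type_set_def)
  qed
  have "connectedin X (\<phi> g ` component x)"
    using connectedin_connected_component_of[of "subtopology X (orbit_type_of x)" x]
    by (intro connectedin_continuous_map_image[OF continuous_map_act[OF g]])
      (simp add: connectedin_subtopology)
  moreover have "\<phi> g ` component x \<subseteq> orbit_type_of x'"
    using act_mem_orbit_type_of[OF g, of _ x] component_subset(1)[of x] type by blast
  ultimately have "\<phi> g ` component x \<subseteq> connected_component_of_set (subtopology X (orbit_type_of x')) (\<phi> g y)"
    using y by (intro connected_component_of_maximal) (auto simp: connectedin_subtopology)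
  also have "\<dots> = component x'"
    using gy by (metis connected_component_of_equiv mem_Collect_eq)
  finally show ?thesis .
qed

lemma stratum_subset_of_inter:
  assumes z: "z \<in> stratum G \<phi> X x" "z \<in> stratum G \<phi> X x'"
  shows "stratum G \<phi> X x \<subseteq> stratum G \<phi> X x'"
proof
  interpret group G by (rule is_group)
  obtain g y where g: "g \<in> carrier G" "y \<in> component x" "z = \<phi> g y"
    using z mem_stratum_iff by blast
  obtain h y' where h: "h \<in> carrier G" "y' \<in> component x'" "z = \<phi> h y'"
    using z mem_stratum_iff by blast
  have top: "y \<in> topspace X" "y' \<in> topspace X"
    using component_subset(2) g h by blast+
  \<comment> \<open>As \<open>z\<close> is a translate of both \<open>y\<close> and
    \<open>y'\<close>, this element takes \<open>y\<close> to \<open>y'\<close> and therefore all of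
    \<open>component x\<close> into \<open>component x'\<close>.\<close>
  let ?k = "inv h \<otimes> g"
  have "\<phi> ?k y = \<phi> (inv h) z"
    using g h(1) top by (simp add: composition_rule)
  also have "\<dots> = y'"
    using h top by (simp add: act_inv)
  finally have "\<phi> ?k y = y'" .
  then have k: "\<phi> ?k ` component x \<subseteq> component x'"
    using g h by (intro act_component_subset) auto
  fix w assume "w \<in> stratum G \<phi> X x"
  then obtain l v where l: "l \<in> carrier G" "v \<in> component x" "w = \<phi> l v"
    using mem_stratum_iff by blast
  have v: "v \<in> topspace X"
    using component_subset(2) l by blast
  \<comment> \<open>Factoring \<open>l\<close> through \<open>?k\<close> exhibits \<open>w\<close>
    as a translate of a point of \<open>component x'\<close>.\<close>
  have "w = \<phi> (l \<otimes> inv ?k) (\<phi> ?k v)"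
    using l g h v composition_rule[of v "l \<otimes> inv ?k" ?k] by (simp add: m_assoc)
  then show "w \<in> stratum G \<phi> X x'"
    unfolding mem_stratum_iff using k l g h by blast
qed

lemma stratum_eq_of_inter:
  "z \<in> stratum G \<phi> X x \<Longrightarrow> z \<in> stratum G \<phi> X x' \<Longrightarrow> stratum G \<phi> X x = stratum G \<phi> X x'"
  using stratum_subset_of_inter by (metis subset_antisym)

section \<open>Categorical sets and locally minimal strata\<close>

lemma G_categoricalE:
  assumes "G_categorical G \<phi> X U"
  obtains H y0 where "openin X U" "invariant_set G \<phi> U"
    "continuous_map (prod_topology (subtopology X U) (top_of_set {0..1::real})) X H"
    "\<And>g x t. g \<in> carrier G \<Longrightarrow> x \<in> U \<Longrightarrow> t \<in> {0..1} \<Longrightarrow> \<phi> g (H (x, t)) = H (\<phi> g x, t)"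
    "\<And>x. x \<in> U \<Longrightarrow> H (x, 0) = x" "y0 \<in> topspace X" "\<And>x. x \<in> U \<Longrightarrow> H (x, 1) \<in> orbit G \<phi> y0"
  using assms unfolding G_categorical_def by blast

text \<open>Growing isotropy means a decreasing orbit type, and local minimality forbids a strict
  decrease inside the neighborhood \<open>W\<close>. The clopen argument on the unit interval then
  keeps the path in the component.\<close>

lemma path_in_locally_minimal_stratum:
  assumes min: "locally_minimal G \<phi> X x"
    and p: "continuous_map (top_of_set {0..1::real}) X p"
    and y: "p 0 \<in> component x"
    and grow: "\<And>t. t \<in> {0..1} \<Longrightarrow> stabilizer G \<phi> (p 0) \<subseteq> stabilizer G \<phi> (p t)"
  shows "p ` {0..1} \<subseteq> component x"
proof -
  obtain W where W: "openin X W" "X closure_of (stratum G \<phi> X x) \<subseteq> W"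
    and le: "\<And>z. z \<in> W \<Longrightarrow> orbit_type_le G (stabilizer G \<phi> z) (stabilizer G \<phi> x)
        \<Longrightarrow> conj_class G (stabilizer G \<phi> z) = conj_class G (stabilizer G \<phi> x)"
    using min unfolding locally_minimal_def by blast
  have "stabilizer G \<phi> (p 0) \<in> conj_class G (stabilizer G \<phi> x)"
    using y component_subset(1)[of x] by (auto simp: orbit_type_set_def)
  \<comment> \<open>This \<open>g\<close> witnesses \<open>orbit_type_le\<close> for every
    \<open>t\<close> at once, because the isotropy at \<open>p t\<close> contains that at
    \<open>p 0\<close>.\<close>
  then obtain g where g: "g \<in> carrier G" "stabilizer G \<phi> (p 0) = conj_set G g (stabilizer G \<phi> x)"
    unfolding conj_class_def by blast
  have "p ` topspace (top_of_set {0..1::real}) \<subseteq> component x"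
  proof (rule image_subset_connected_component_of[OF _ _ p W(1), where ?t0.0 = 0])
    show "connected_space (top_of_set {0..1::real})"
      by (simp flip: connectedin_def add: connected_space_subtopology)
    show "locally_connected_space (top_of_set {0..1::real})"
      by (simp add: locally_connected_real_interval)
    show "X closure_of component x \<subseteq> W"
      using W(2) closure_of_mono[OF component_subset_stratum] by blast
    fix t assume t: "t \<in> topspace (top_of_set {0..1::real})" "p t \<in> W"
    then have "orbit_type_le G (stabilizer G \<phi> (p t)) (stabilizer G \<phi> x)"
      unfolding orbit_type_le_def using grow g by auto
    then show "p t \<in> orbit_type_of x"
      using le t openin_subset[OF W(1)] by (auto simp: mem_orbit_type_of_iff)
  qed (use y in auto)
  then show ?thesis
    by simp
qed

text \<open>One categorical set is fixed together with its homotopy and its target point, so that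
  the same \<open>y0\<close> can be tested against different strata.\<close>

context
  fixes U H y0
  assumes U: "openin X U" "invariant_set G \<phi> U"
    and H: "continuous_map (prod_topology (subtopology X U) (top_of_set {0..1::real})) X H"
    and equiv: "\<And>g x t. g \<in> carrier G \<Longrightarrow> x \<in> U \<Longrightarrow> t \<in> {0..1} \<Longrightarrow> \<phi> g (H (x, t)) = H (\<phi> g x, t)"
    and H0: "\<And>x. x \<in> U \<Longrightarrow> H (x, 0) = x"
    and H1: "y0 \<in> topspace X" "\<And>x. x \<in> U \<Longrightarrow> H (x, 1) \<in> orbit G \<phi> y0"
begin

lemma homotopy_in_locally_minimal_stratum:
  assumes min: "locally_minimal G \<phi> X x" and z: "z \<in> U" "z \<in> stratum G \<phi> X x" and t: "t \<in> {0..1}"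
  shows "H (z, t) \<in> stratum G \<phi> X x"
proof -
  \<comment> \<open>The point \<open>z\<close> may lie in another translate of the component, so the
    track of a point \<open>y\<close> in \<open>component x\<close> is followed and carried over to
    \<open>z\<close> by equivariance.\<close>
  interpret group G by (rule is_group)
  obtain g y where g: "g \<in> carrier G" "y \<in> component x" "z = \<phi> g y"
    using z mem_stratum_iff by blast
  have y: "y \<in> topspace X"
    using component_subset(2) g by blast
  then have "y = \<phi> (inv g) z"
    using g by (simp add: act_inv)
  then have yU: "y \<in> U"
    using U(2) z(1) g(1) unfolding invariant_set_def by blast
  have "continuous_map (top_of_set {0..1::real}) (prod_topology (subtopology X U) (top_of_set {0..1})) (\<lambda>t. (y, t))"
    using y yU by (simp add: continuous_map_pairwise o_def)
  then have p: "continuous_map (top_of_set {0..1::real}) X (\<lambda>t. H (y, t))"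
    using continuous_map_compose[OF _ H] by (simp add: o_def)
  have "(\<lambda>t. H (y, t)) ` {0..1} \<subseteq> component x"
  proof (rule path_in_locally_minimal_stratum[OF min p])
    show "H (y, 0) \<in> component x"
      using g yU by (simp add: H0)
    \<comment> \<open>If \<open>s\<close> fixes \<open>y\<close>, then equivariance gives
      \<open>\<phi> s (H (y, t)) = H (\<phi> s y, t) = H (y, t)\<close>.\<close>
    show "stabilizer G \<phi> (H (y, 0)) \<subseteq> stabilizer G \<phi> (H (y, t))" if "t \<in> {0..1}" for t
      using that yU by (auto simp: H0 stabilizer_def equiv)
  qed
  moreover have "H (z, t) = \<phi> g (H (y, t))"
    using g t yU by (simp add: equiv)
  ultimately show ?thesis
    unfolding mem_stratum_iff using g t by blast
qed

text \<open>The end of the track of \<open>z\<close> lies in the stratum and in the orbit of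
  \<open>y0\<close>; invariance of the stratum brings \<open>y0\<close> along.\<close>

lemma target_in_locally_minimal_stratum:
  assumes "locally_minimal G \<phi> X x" "z \<in> U" "z \<in> stratum G \<phi> X x"
  shows "y0 \<in> stratum G \<phi> X x"
proof -
  interpret group G by (rule is_group)
  obtain g where g: "g \<in> carrier G" "H (z, 1) = \<phi> g y0"
    using H1 assms(2) unfolding orbit_def by blast
  then have "\<phi> (inv g) (H (z, 1)) = y0"
    using H1 by (simp add: act_inv)
  then show ?thesis
    using act_mem_stratum[of "inv g" "H (z, 1)" x] g
      homotopy_in_locally_minimal_stratum[OF assms, of 1] by simp
qed

text \<open>The homotopy \<open>H\<close> itself serves for the trace of \<open>U\<close>. The point
  \<open>z\<close> ensures that \<open>y0\<close> lies in the stratum, as the target point has to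
  belong to the space.\<close>

lemma G_categorical_stratum_aux:
  assumes min: "locally_minimal G \<phi> X x" and z: "z \<in> U" "z \<in> stratum G \<phi> X x"
  shows "G_categorical G \<phi> (subtopology X (stratum G \<phi> X x)) (U \<inter> stratum G \<phi> X x)"
proof -
  let ?S = "stratum G \<phi> X x"
  let ?I = "top_of_set {0..1::real}"
  \<comment> \<open>The new domain is recognized as a subspace of the domain of \<open>H\<close>, so
    continuity is inherited.\<close>
  have "prod_topology (subtopology (subtopology X ?S) (U \<inter> ?S)) ?I
      = subtopology (prod_topology (subtopology X U) ?I) ((U \<inter> ?S) \<times> UNIV)"
    by (simp add: subtopology_subtopology prod_topology_subtopology Int_ac Times_Int_Times)
  then have "continuous_map (prod_topology (subtopology (subtopology X ?S) (U \<inter> ?S)) ?I) X H"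
    using H by (simp add: continuous_map_from_subtopology)
  then have "continuous_map (prod_topology (subtopology (subtopology X ?S) (U \<inter> ?S)) ?I)
      (subtopology X ?S) H"
    using homotopy_in_locally_minimal_stratum[OF min]
    by (auto simp: continuous_map_in_subtopology)
  moreover have "openin (subtopology X ?S) (U \<inter> ?S)"
    using U(1) openin_subtopology by blast
  moreover have "invariant_set G \<phi> (U \<inter> ?S)"
    using U(2) act_mem_stratum unfolding invariant_set_def by blast
  moreover have "y0 \<in> topspace (subtopology X ?S)"
    using H1 target_in_locally_minimal_stratum[OF min z] by simp
  ultimately show ?thesis
    unfolding G_categorical_def using equiv H0 H1 by blast
qed

end

lemma G_categorical_stratum:
  assumes "G_categorical G \<phi> X U" "locally_minimal G \<phi> X x" "U \<inter> stratum G \<phi> X x \<noteq> {}"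
  shows "G_categorical G \<phi> (subtopology X (stratum G \<phi> X x)) (U \<inter> stratum G \<phi> X x)"
proof -
  obtain z where z: "z \<in> U" "z \<in> stratum G \<phi> X x"
    using assms(3) by blast
  show ?thesis
    using assms(1) by (rule G_categoricalE) (rule G_categorical_stratum_aux[OF _ _ _ _ _ _ _ assms(2) z])
qed

lemma G_categorical_meets_one_stratum:
  assumes "G_categorical G \<phi> X U"
    and "locally_minimal G \<phi> X x" "U \<inter> stratum G \<phi> X x \<noteq> {}"
    and "locally_minimal G \<phi> X x'" "U \<inter> stratum G \<phi> X x' \<noteq> {}"
  shows "stratum G \<phi> X x = stratum G \<phi> X x'"
proof -
  obtain z z' where z: "z \<in> U" "z \<in> stratum G \<phi> X x" "z' \<in> U" "z' \<in> stratum G \<phi> X x'"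
    using assms(3,5) by blast
  from assms(1) obtain H y0 where cat: "openin X U" "invariant_set G \<phi> U"
    "continuous_map (prod_topology (subtopology X U) (top_of_set {0..1::real})) X H"
    "\<And>g x t. g \<in> carrier G \<Longrightarrow> x \<in> U \<Longrightarrow> t \<in> {0..1} \<Longrightarrow> \<phi> g (H (x, t)) = H (\<phi> g x, t)"
    "\<And>x. x \<in> U \<Longrightarrow> H (x, 0) = x" "y0 \<in> topspace X" "\<And>x. x \<in> U \<Longrightarrow> H (x, 1) \<in> orbit G \<phi> y0"
    by (rule G_categoricalE) blast
  have "y0 \<in> stratum G \<phi> X x"
    using cat assms(2) z(1,2) by (rule target_in_locally_minimal_stratum)
  moreover have "y0 \<in> stratum G \<phi> X x'"
    using cat assms(4) z(3,4) by (rule target_in_locally_minimal_stratum)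
  ultimately show ?thesis
    by (rule stratum_eq_of_inter)
qed

section \<open>Counting the members of a cover\<close>

lemma locally_minimal_strataE:
  assumes "S \<in> locally_minimal_strata G \<phi> X"
  obtains x where "S = stratum G \<phi> X x" "locally_minimal G \<phi> X x" "x \<in> S"
  using assms mem_component_self component_subset_stratum
  unfolding locally_minimal_strata_def by blast

lemma one_le_cat_G_stratum:
  assumes "S \<in> locally_minimal_strata G \<phi> X"
  shows "1 \<le> cat_G G \<phi> (subtopology X S)"
  unfolding cat_G_def
proof (rule Inf_greatest, clarify)
  fix C assume C: "finite C" "\<Union>C = topspace (subtopology X S)"
  \<comment> \<open>A stratum contains its base point, which rules out the empty cover.\<close>
  obtain x where "S = stratum G \<phi> X x" "x \<in> S"
    using assms by (rule locally_minimal_strataE)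
  then have "C \<noteq> {}"
    using C(2) stratum_subset_topspace[of x] by auto
  then have "1 \<le> card C"
    using C(1) by (simp add: Suc_le_eq card_gt_0_iff)
  then show "1 \<le> enat (card C)"
    by (simp add: one_enat_def)
qed

lemma cat_G_stratum_le:
  assumes C: "finite C" "\<And>U. U \<in> C \<Longrightarrow> G_categorical G \<phi> X U" "\<Union>C = topspace X"
    and S: "S \<in> locally_minimal_strata G \<phi> X"
  shows "cat_G G \<phi> (subtopology X S) \<le> enat (card {U \<in> C. U \<inter> S \<noteq> {}})"
proof -
  obtain x where x: "S = stratum G \<phi> X x" "locally_minimal G \<phi> X x"
    using S by (rule locally_minimal_strataE)
  let ?D = "(\<lambda>U. U \<inter> S) ` {U \<in> C. U \<inter> S \<noteq> {}}"
  have "\<forall>V\<in>?D. G_categorical G \<phi> (subtopology X S) V"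
    using G_categorical_stratum[OF C(2) x(2)] x(1) by blast
  moreover have "\<Union>?D = topspace (subtopology X S)"
    using C(3) by auto
  ultimately have "cat_G G \<phi> (subtopology X S) \<le> enat (card ?D)"
    unfolding cat_G_def using C(1) by (intro Inf_lower CollectI exI[of _ ?D]) simp
  \<comment> \<open>Only an inequality, since different members of \<open>C\<close> may have the
    same trace on \<open>S\<close>.\<close>
  also have "\<dots> \<le> enat (card {U \<in> C. U \<inter> S \<noteq> {}})"
    using C(1) by (simp add: card_image_le)
  finally show ?thesis .
qed

lemma ecard_locally_minimal_strata_le:
  "ecard (locally_minimal_strata G \<phi> X)
     \<le> (\<Sum>\<^sub>\<infinity>S\<in>locally_minimal_strata G \<phi> X. cat_G G \<phi> (subtopology X S))"
proof (cases "finite (locally_minimal_strata G \<phi> X)")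
  case True
  have "(\<Sum>S\<in>locally_minimal_strata G \<phi> X. 1) \<le> (\<Sum>S\<in>locally_minimal_strata G \<phi> X. cat_G G \<phi> (subtopology X S))"
    by (rule sum_mono) (rule one_le_cat_G_stratum)
  with True show ?thesis
    by (simp add: ecard_def of_nat_eq_enat)
next
  case False
  \<comment> \<open>Infinitely many terms, each at least \<open>1\<close>, have the sum
    \<infinity>.\<close>
  then have "(\<Sum>\<^sub>\<infinity>S\<in>locally_minimal_strata G \<phi> X. cat_G G \<phi> (subtopology X S)) = \<infinity>"
    by (intro infsum_superconst_infinite_enat[where b = 1] one_le_cat_G_stratum) auto
  then show ?thesis
    by simp
qed

text \<open>It suffices to bound the sum by the size of each finite categorical cover
  \<open>C\<close>. The members of \<open>C\<close> that meet a given locally minimal stratum bound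
  its category, and these subfamilies are disjoint for different strata.\<close>

lemma infsum_cat_G_strata_le:
  "(\<Sum>\<^sub>\<infinity>S\<in>locally_minimal_strata G \<phi> X. cat_G G \<phi> (subtopology X S)) \<le> cat_G G \<phi> X"
  unfolding cat_G_def[of G \<phi> X]
proof (rule Inf_greatest, clarify)
  fix C assume C: "finite C" "\<forall>U\<in>C. G_categorical G \<phi> X U" "\<Union>C = topspace X"
  let ?F = "locally_minimal_strata G \<phi> X"
  define D where "D S = {U \<in> C. U \<inter> S \<noteq> {}}" for S
  have one: "S = S'" if S: "S \<in> ?F" "S' \<in> ?F" "U \<in> D S" "U \<in> D S'" for S S' U
  proof -
    obtain x x' where x: "S = stratum G \<phi> X x" "locally_minimal G \<phi> X x"
      "S' = stratum G \<phi> X x'" "locally_minimal G \<phi> X x'"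
      using S(1,2) by (metis locally_minimal_strataE)
    then show ?thesis
      using S C(2) G_categorical_meets_one_stratum[of U x x'] by (simp add: D_def)
  qed
  have nonempty: "D S \<noteq> {}" if "S \<in> ?F" for S
    using that C(3) stratum_subset_topspace
    by (elim locally_minimal_strataE) (fastforce simp: D_def)
  \<comment> \<open>Nonempty disjoint subfamilies are distinct, so the strata embed into
    \<open>Pow C\<close>. This makes them finite in number and turns the infinite sum into a finite
    one.\<close>
  have "inj_on D ?F"
    using one nonempty by (intro inj_onI) blast
  moreover have "D ` ?F \<subseteq> Pow C"
    by (auto simp: D_def)
  ultimately have fin: "finite ?F"
    by (rule inj_on_finite) (simp add: C(1))
  then have "(\<Sum>\<^sub>\<infinity>S\<in>?F. cat_G G \<phi> (subtopology X S)) = (\<Sum>S\<in>?F. cat_G G \<phi> (subtopology X S))"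
    by simp
  also have "\<dots> \<le> (\<Sum>S\<in>?F. enat (card (D S)))"
    unfolding D_def by (intro sum_mono cat_G_stratum_le) (use C in auto)
  also have "\<dots> = enat (\<Sum>S\<in>?F. card (D S))"
    by (simp flip: of_nat_eq_enat)
  also have "(\<Sum>S\<in>?F. card (D S)) = card (\<Union>S\<in>?F. D S)"
  proof (rule card_UN_disjoint[symmetric, OF fin])
    show "\<forall>S\<in>?F. finite (D S)"
      using C(1) by (simp add: D_def)
    show "\<forall>S\<in>?F. \<forall>S'\<in>?F. S \<noteq> S' \<longrightarrow> D S \<inter> D S' = {}"
      using one by (meson disjoint_iff)
  qed
  also have "enat \<dots> \<le> enat (card C)"
    using C(1) by (auto simp: D_def intro!: card_mono)
  finally show "(\<Sum>\<^sub>\<infinity>S\<in>?F. cat_G G \<phi> (subtopology X S)) \<le> enat (card C)" .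
qed

end

section \<open>From smooth actions to continuous translations\<close>

lemma smooth_action_imp_continuous_action:
  assumes L: "lie_group G L" and "smooth_action G L M \<phi>"
  shows "continuous_action G (mtop M) \<phi>"
proof -
  have act: "group_action G (topspace (mtop M)) \<phi>"
    and cont: "continuous_map (prod_topology (mtop L) (mtop M)) (mtop M) (\<lambda>(g, x). \<phi> g x)"
    using assms by (simp_all add: smooth_action_def smooth_map_def prod_mfd_def)
  have "continuous_map (mtop M) (mtop M) (\<phi> g)" if "g \<in> carrier G" for g
  proof -
    \<comment> \<open>The slice \<open>\<lambda>x. (g, x)\<close> maps into the product only because
      the carrier of \<open>G\<close> is the underlying space of \<open>L\<close>.\<close>
    have "g \<in> topspace (mtop L)"
      using that L by (simp add: lie_group_def)
    then have "continuous_map (mtop M) (prod_topology (mtop L) (mtop M)) (\<lambda>x. (g, x))"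
      by (simp add: continuous_map_pairwise o_def)
    from continuous_map_compose[OF this cont] show ?thesis
      by (simp add: o_def)
  qed
  with act show ?thesis
    by (simp add: continuous_action_def continuous_action_axioms_def)
qed

theorem theorem3p7:
  fixes G :: "('g, 'r) monoid_scheme" and L :: "'g mfd"
    and M :: "'m mfd" and \<phi> :: "'g \<Rightarrow> 'm \<Rightarrow> 'm"
  assumes "lie_group G L"
    and "smooth_manifold M"
    and "smooth_action G L M \<phi>"
    and "proper_action (mtop L) (mtop M) \<phi>"
  shows "ecard (locally_minimal_strata G \<phi> (mtop M))
           \<le> (\<Sum>\<^sub>\<infinity>S\<in>locally_minimal_strata G \<phi> (mtop M). cat_G G \<phi> (subtopology (mtop M) S)) \<and>
         (\<Sum>\<^sub>\<infinity>S\<in>locally_minimal_strata G \<phi> (mtop M). cat_G G \<phi> (subtopology (mtop M) S))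
           \<le> cat_G G \<phi> (mtop M)"
proof -
  interpret continuous_action G "mtop M" \<phi>
    using assms(1,3) by (rule smooth_action_imp_continuous_action)
  show ?thesis
    using ecard_locally_minimal_strata_le infsum_cat_G_strata_le by blast
qed

end
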